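(* Let $n\ge2$ be an integer, $\lambda=\frac{n-1}{2}$, $m\in\mathbb N=\{1,2,\dots\}$. The Euclidean limit $g^m$ of the Poisson wavelets of order $m$ on $\mathcal S^n$ decays at infinity polynomially with degree $$d=m+n+\epsilon,\qquad \epsilon=(m+1)\bmod 2\in\{0,1\},$$ i.e. there are constants $0<c\le C$ and $\rho_0>0$ such that $c\,|\xi|^{-d}\le|g^m(|\xi|)|\le C\,|\xi|^{-d}$ for all $\xi\in\mathbb R^n$ with $|\xi|\ge\rho_0$.
   Context: The Gegenbauer polynomials are $$C_l^\lambda(t)=\sum_{k=0}^{[l/2]} (-1)^k\frac{\Gamma(l-k+\lambda)}{\Gamma(\lambda)\,k!\,(l-2k)!}\,(2t)^{l-2k},$$ and $\Sigma_n=\frac{2\pi^{\lambda+1}}{\Gamma(\lambda+1)}$ is the surface measure of the unit sphere $\mathcal S^n\subset\mathbb R^{n+1}$. The Euclidean limit of the Poisson wavelets of order $m$ is the function $g^m$ of $|\xi|$, $\xi\in\mathbb R^n$, given by $$g^m(|\xi|)=\frac{1}{\Sigma_n\lambda}\,(m+1)!\,\frac{C_{m+1}^\lambda\bigl(1/\sqrt{1+|\xi|^2}\bigr)}{\left(1+|\xi|^2\right)^{(m+n)/2}}.$$ *)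

theory Defs
  imports "HOL-Analysis.Analysis"
begin

text \<open>For \<open>l - 2 * k\<close> the subtraction on naturals is exact, since \<open>k \<le> l div 2\<close>.\<close>

definition gegenbauer :: "nat \<Rightarrow> real \<Rightarrow> real \<Rightarrow> real" where
  "gegenbauer l lam t =
     (\<Sum>k = 0..l div 2. (-1) ^ k * (Gamma (real l - real k + lam) / (Gamma lam * fact k * fact (l - 2 * k)))
        * (2 * t) ^ (l - 2 * k))"

definition gegenbauer_index :: "nat \<Rightarrow> real" where
  "gegenbauer_index n = (real n - 1) / 2"

text \<open>Surface measure of the unit sphere of dimension \<open>n\<close>, sitting in the Euclidean space of
  dimension \<open>n + 1\<close>.\<close>

definition sphere_surface :: "nat \<Rightarrow> real" where
  "sphere_surface n = (let lam = gegenbauer_index n in 2 * pi powr (lam + 1) / Gamma (lam + 1))"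

text \<open>Euclidean limit of the Poisson wavelets of order \<open>m\<close> on the \<open>n\<close>-dimensional unit sphere,
  as a function of the radius \<open>r\<close>.\<close>

definition poisson_euclidean_limit :: "nat \<Rightarrow> nat \<Rightarrow> real \<Rightarrow> real" where
  "poisson_euclidean_limit n m r =
     (let lam = gegenbauer_index n in
      1 / (sphere_surface n * lam) * fact (m + 1)
        * (gegenbauer (m + 1) lam (1 / sqrt (1 + r\<^sup>2)) / (1 + r\<^sup>2) powr (real (m + n) / 2)))"

text \<open>Two-sided bound: \<open>d\<close> is the exact order of decay, not merely an upper bound for it.\<close>

definition decays_polynomially_with_degree :: "('a::real_normed_vector \<Rightarrow> real) \<Rightarrow> nat \<Rightarrow> bool" where
  "decays_polynomially_with_degree f d \<longleftrightarrow>
     (\<exists>c C \<rho>\<^sub>0. 0 < c \<and> c \<le> C \<and> 0 < \<rho>\<^sub>0 \<and>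
        (\<forall>\<xi>. norm \<xi> \<ge> \<rho>\<^sub>0 \<longrightarrow>
           c * norm \<xi> powi (- int d) \<le> \<bar>f \<xi>\<bar> \<and> \<bar>f \<xi>\<bar> \<le> C * norm \<xi> powi (- int d)))"

end

theory Submission
  imports Defs "HOL-Real_Asymp.Real_Asymp"
begin

text \<open>
  Put \<open>t = 1 / sqrt (1 + r\<^sup>2)\<close>. The wavelet limit is a nonzero constant times
  \<open>C t * t ^ (m + n)\<close>, where \<open>C\<close> is the Gegenbauer polynomial of degree \<open>m + 1\<close>. As \<open>r\<close> tends to
  infinity, \<open>t\<close> tends to \<open>0\<close> with \<open>t * r\<close> tending to \<open>1\<close>, so the rate of decay is governed by the order
  of vanishing of \<open>C\<close> at the origin. A Gegenbauer polynomial has the parity of its degree, and its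
  coefficient of lowest admissible degree, \<open>0\<close> or \<open>1\<close>, is a nonzero quotient of Gamma values when
  \<open>\<lambda> > 0\<close>. Hence \<open>C\<close> vanishes exactly to order \<open>\<epsilon> = (m + 1) mod 2\<close>, and \<open>r ^ (m + n + \<epsilon>)\<close> times
  the wavelet limit converges to a nonzero number. Such a limit, from
  \<open>poisson_euclidean_limit_times_power_tendsto\<close>, is stronger than the two-sided bound, which
  \<open>decays_polynomially_if_limit\<close> extracts from it.
\<close>

lemma decays_polynomially_if_limit:
  fixes g :: "real \<Rightarrow> real"
  assumes lim: "((\<lambda>r. g r * r ^ d) \<longlongrightarrow> A) at_top" and "A \<noteq> 0"
  shows "decays_polynomially_with_degree (\<lambda>\<xi> :: 'a::real_normed_vector. g (norm \<xi>)) d"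
proof -
  have "((\<lambda>r. \<bar>g r * r ^ d\<bar>) \<longlongrightarrow> \<bar>A\<bar>) at_top"
    by (intro tendsto_rabs lim)
  then have "\<forall>\<^sub>F r in at_top. \<bar>A\<bar> / 2 < \<bar>g r * r ^ d\<bar> \<and> \<bar>g r * r ^ d\<bar> < 2 * \<bar>A\<bar>"
    using \<open>A \<noteq> 0\<close> by (intro eventually_conj order_tendstoD[where y = "\<bar>A\<bar>"]) simp_all
  then obtain R where R: "\<And>r. R \<le> r \<Longrightarrow> \<bar>A\<bar> / 2 < \<bar>g r * r ^ d\<bar> \<and> \<bar>g r * r ^ d\<bar> < 2 * \<bar>A\<bar>"
    by (auto simp: eventually_at_top_linorder)
  have "\<bar>A\<bar> / 2 * r powi (- int d) \<le> \<bar>g r\<bar> \<and> \<bar>g r\<bar> \<le> 2 * \<bar>A\<bar> * r powi (- int d)"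
    if "max R 1 \<le> r" for r
  proof -
    have "r > 0" and "R \<le> r"
      using that by auto
    then show ?thesis
      using R[of r] by (simp add: power_int_minus abs_mult field_simps)
  qed
  then show ?thesis
    unfolding decays_polynomially_with_degree_def using \<open>A \<noteq> 0\<close>
    by (intro exI[of _ "\<bar>A\<bar> / 2"] exI[of _ "2 * \<bar>A\<bar>"] exI[of _ "max R 1"]) auto
qed

text \<open>
  All exponents \<open>l - 2 * k\<close> have the parity of \<open>l\<close>, so \<open>t ^ (l mod 2)\<close> factors out of the polynomial.
  In the cofactor only the summand \<open>k = l div 2\<close> survives at \<open>t = 0\<close>; positivity of \<open>\<lambda>\<close> keeps
  both Gamma values of that summand nonzero.
\<close>

lemma gegenbauer_order_at_0:
  assumes "lam > 0"
  obtains A where "A \<noteq> 0" and "((\<lambda>t. gegenbauer l lam t / t ^ (l mod 2)) \<longlongrightarrow> A) (at 0)"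
proof -
  define a where
    "a k = (-1) ^ k * (Gamma (real l - real k + lam) / (Gamma lam * fact k * fact (l - 2 * k)))
       * 2 ^ (l - 2 * k)" for k
  define Q where "Q t = (\<Sum>k = 0..l div 2. a k * t ^ (2 * (l div 2 - k)))" for t
  have Q: "gegenbauer l lam t = t ^ (l mod 2) * Q t" for t
    unfolding gegenbauer_def Q_def sum_distrib_left
  proof (rule sum.cong)
    fix k assume "k \<in> {0..l div 2}"
    then have "l - 2 * k = l mod 2 + 2 * (l div 2 - k)"
      using mod_mult_div_eq[of l 2] by (simp add: algebra_simps)
    then have "t ^ (l - 2 * k) = t ^ (l mod 2) * t ^ (2 * (l div 2 - k))"
      by (simp only: power_add)
    then show "(-1) ^ k * (Gamma (real l - real k + lam) / (Gamma lam * fact k * fact (l - 2 * k)))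
        * (2 * t) ^ (l - 2 * k) = t ^ (l mod 2) * (a k * t ^ (2 * (l div 2 - k)))"
      by (simp only: a_def power_mult_distrib mult_ac)
  qed simp
  have "Q 0 = (\<Sum>k = 0..l div 2. if k = l div 2 then a k else 0)"
    unfolding Q_def by (rule sum.cong) (auto simp: power_0_left)
  also have "\<dots> = a (l div 2)"
    by simp
  finally have Q0: "Q 0 = a (l div 2)" .
  have "real l - real (l div 2) + lam > 0"
    using assms by linarith
  then have "Gamma (real l - real (l div 2) + lam) \<noteq> 0" and "Gamma lam \<noteq> 0"
    using assms by (metis Gamma_real_pos less_irrefl)+
  then have "Q 0 \<noteq> 0"
    unfolding Q0 a_def by simp
  have "isCont Q 0"
    unfolding Q_def by (intro continuous_intros)
  then have "(Q \<longlongrightarrow> Q 0) (at 0)"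
    by (simp add: isCont_def)
  moreover have "\<forall>\<^sub>F t in at 0. gegenbauer l lam t / t ^ (l mod 2) = Q t"
    by (simp add: eventually_at_filter Q)
  ultimately have "((\<lambda>t. gegenbauer l lam t / t ^ (l mod 2)) \<longlongrightarrow> Q 0) (at 0)"
    by (simp add: tendsto_cong)
  with \<open>Q 0 \<noteq> 0\<close> show thesis
    by (rule that)
qed

text \<open>
  For \<open>t = 1 / sqrt (1 + r\<^sup>2)\<close>, the factor \<open>t ^ (m + n)\<close> from the denominator and the factor
  \<open>t ^ ((m + 1) mod 2)\<close> from the vanishing of the Gegenbauer polynomial are balanced by the power
  of \<open>r\<close>, because \<open>t * r\<close> tends to \<open>1\<close>. The condition on \<open>n\<close> makes the index \<open>\<lambda>\<close> positive.
\<close>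

lemma poisson_euclidean_limit_times_power_tendsto:
  assumes "n \<ge> 2"
  obtains A where "A \<noteq> 0"
    and "((\<lambda>r. poisson_euclidean_limit n m r * r ^ (m + n + (m + 1) mod 2)) \<longlongrightarrow> A) at_top"
proof -
  let ?\<epsilon> = "(m + 1) mod 2"
  define lam where "lam = gegenbauer_index n"
  define K where "K = 1 / (sphere_surface n * lam) * fact (m + 1)"
  define t where "t r = 1 / sqrt (1 + r\<^sup>2)" for r :: real
  have "lam > 0"
    using assms by (simp add: lam_def gegenbauer_index_def)
  then have "sphere_surface n > 0"
    by (simp add: sphere_surface_def Let_def flip: lam_def)
  with \<open>lam > 0\<close> have "K \<noteq> 0"
    by (simp add: K_def)
  obtain B where "B \<noteq> 0"
    and B: "((\<lambda>t. gegenbauer (m + 1) lam t / t ^ ?\<epsilon>) \<longlongrightarrow> B) (at 0)"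
    using gegenbauer_order_at_0[OF \<open>lam > 0\<close>] .
  have t_pos: "t r > 0" for r
    by (simp add: t_def add_pos_nonneg)
  have "(t \<longlongrightarrow> 0) at_top"
    unfolding t_def by real_asymp
  then have "filterlim t (at 0) at_top"
    using t_pos by (simp add: filterlim_at less_imp_neq[symmetric])
  then have "((\<lambda>r. gegenbauer (m + 1) lam (t r) / t r ^ ?\<epsilon>) \<longlongrightarrow> B) at_top"
    by (rule filterlim_compose[OF B])
  moreover have "((\<lambda>r. t r * r) \<longlongrightarrow> 1) at_top"
    unfolding t_def by real_asymp
  ultimately have "((\<lambda>r. K * (gegenbauer (m + 1) lam (t r) / t r ^ ?\<epsilon>)
      * (t r * r) ^ (m + n + ?\<epsilon>)) \<longlongrightarrow> K * B * 1 ^ (m + n + ?\<epsilon>)) at_top"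
    by (intro tendsto_intros)
  moreover have "poisson_euclidean_limit n m r * r ^ (m + n + ?\<epsilon>)
      = K * (gegenbauer (m + 1) lam (t r) / t r ^ ?\<epsilon>) * (t r * r) ^ (m + n + ?\<epsilon>)" for r
  proof -
    have "1 + r\<^sup>2 > 0"
      by (simp add: add_pos_nonneg)
    then have "(1 + r\<^sup>2) powr (real (m + n) / 2) = sqrt (1 + r\<^sup>2) ^ (m + n)"
      using powr_half_sqrt_powr[of "1 + r\<^sup>2" "real (m + n)"]
      by (simp only: powr_realpow real_sqrt_power less_imp_le)
    then have "poisson_euclidean_limit n m r
        = K * (gegenbauer (m + 1) lam (t r) / sqrt (1 + r\<^sup>2) ^ (m + n))"
      by (simp only: poisson_euclidean_limit_def Let_def K_def t_def lam_def)
    also have "\<dots> = K * (gegenbauer (m + 1) lam (t r) * t r ^ (m + n))"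
      by (simp add: t_def power_one_over)
    finally show ?thesis
      using t_pos[of r] by (simp add: power_add power_mult_distrib)
  qed
  ultimately have
    "((\<lambda>r. poisson_euclidean_limit n m r * r ^ (m + n + ?\<epsilon>)) \<longlongrightarrow> K * B) at_top"
    by simp
  moreover have "K * B \<noteq> 0"
    using \<open>K \<noteq> 0\<close> \<open>B \<noteq> 0\<close> by simp
  ultimately show thesis
    using that by blast
qed

theorem proposition7p2:
  fixes n m d \<epsilon> :: nat
  assumes "CARD('n::finite) = n" and "n \<ge> 2" and "m \<ge> 1"
    and "\<epsilon> = (m + 1) mod 2" and "d = m + n + \<epsilon>"
  shows "decays_polynomially_with_degree
           (\<lambda>\<xi> :: real ^ 'n. poisson_euclidean_limit n m (norm \<xi>)) d"
proof -
  obtain A where "A \<noteq> 0" and "((\<lambda>r. poisson_euclidean_limit n m r * r ^ d) \<longlongrightarrow> A) at_top"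
    unfolding assms(4,5) using poisson_euclidean_limit_times_power_tendsto[OF assms(2)] .
  then show ?thesis
    by (intro decays_polynomially_if_limit)
qed

end
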